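(* Let $\mu > 0$ and let $\mathrm{smax}_\mu : \mathbb{R}^d \to \mathbb{R}$ be given by $\mathrm{smax}_\mu(x) = \mu \log\left(\sum_{i=1}^d e^{x_i/\mu}\right)$. Then, for all $x, h \in \mathbb{R}^d$, $$\left|\nabla^4 \mathrm{smax}_\mu(x)[h,h,h,h]\right| \leq \frac{15}{\mu^3} \|h\|_2^4.$$
   Context: $\nabla^4 g(x)[h,h,h,h]$ denotes the fourth derivative of $g$ at $x$ (a symmetric $4$-linear form) evaluated at $(h,h,h,h)$. *)

theory Defs
  imports "HOL-Analysis.Analysis"
begin

definition smax :: "real \<Rightarrow> real ^ 'd \<Rightarrow> real" where
  "smax \<mu> x = \<mu> * ln (\<Sum>i\<in>UNIV. exp (x $ i / \<mu>))"

(* frechet_derivative, packaged as an element of the normed space of bounded linear maps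
   so that the derivative map can itself be differentiated.  As for frechet_derivative,
   the value is meaningful only at points of differentiability. *)
definition nabla ::
  "('a::real_normed_vector \<Rightarrow> 'b::real_normed_vector) \<Rightarrow> 'a \<Rightarrow> 'a \<Rightarrow>\<^sub>L 'b" where
  "nabla f x = Blinfun (frechet_derivative f (at x))"

lemma nabla_eqI:
  assumes "(f has_derivative blinfun_apply D) (at x)"
  shows "nabla f x = D"
  using frechet_derivative_at[OF assms] by (metis nabla_def blinfun_apply_inverse)

lemma has_derivative_nabla:
  assumes "f differentiable (at x)"
  shows "(f has_derivative blinfun_apply (nabla f x)) (at x)"
proof -
  have d: "(f has_derivative frechet_derivative f (at x)) (at x)"
    using assms by (simp add: frechet_derivative_works)
  then show ?thesis
    by (simp add: nabla_def bounded_linear_Blinfun_apply[OF has_derivative_bounded_linear[OF d]])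
qed

definition nabla4 ::
  "('a::real_normed_vector \<Rightarrow> 'b::real_normed_vector) \<Rightarrow> 'a \<Rightarrow> 'a \<Rightarrow>\<^sub>L 'a \<Rightarrow>\<^sub>L 'a \<Rightarrow>\<^sub>L 'a \<Rightarrow>\<^sub>L 'b" where
  "nabla4 f = nabla (nabla (nabla (nabla f)))"

(* nabla4 f x [h1, h2, h3, h4]; h1 is the direction of the outermost (last) differentiation. *)
definition nabla4_form ::
  "('a::real_normed_vector \<Rightarrow> 'b::real_normed_vector) \<Rightarrow> 'a \<Rightarrow> 'a \<Rightarrow> 'a \<Rightarrow> 'a \<Rightarrow> 'a \<Rightarrow> 'b" where
  "nabla4_form f x h1 h2 h3 h4 =
     blinfun_apply (blinfun_apply (blinfun_apply (blinfun_apply (nabla4 f x) h1) h2) h3) h4"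

end

theory Submission
  imports Defs
begin

text \<open>The gradient of the softmax function is the Gibbs distribution \<open>p\<close> with weights
\<open>exp (x $ i / \<mu>)\<close>. Its derivatives are again polynomials in \<open>p\<close>, so \<open>smax\<close> is smooth, and
\<open>\<mu> ^ 3\<close> times the fourth derivative in direction \<open>h\<close> is the fourth cumulant
\<open>E (h - E h) ^ 4 - 3 (Var h)\<^sup>2\<close> of \<open>h\<close> under \<open>p\<close>. Since \<open>\<bar>h $ i - E h\<bar> \<le> 2 * norm h\<close> and
\<open>Var h \<le> (norm h)\<^sup>2\<close>, it lies between \<open>- 3 * norm h ^ 4\<close> and \<open>4 * norm h ^ 4\<close>.\<close>

section \<open>The Gibbs distribution\<close>

definition gibbs :: "real \<Rightarrow> 'd::finite \<Rightarrow> real ^ 'd \<Rightarrow> real" where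
  "gibbs \<mu> i x = exp (x $ i / \<mu>) / (\<Sum>j\<in>UNIV. exp (x $ j / \<mu>))"

text \<open>The argument \<open>a\<close> is any family of reals, not a vector, so that powers
  \<open>h $ i ^ n\<close> and shifts \<open>h $ i - m\<close> can be averaged directly.\<close>

definition gibbs_mean :: "real \<Rightarrow> real ^ 'd \<Rightarrow> ('d \<Rightarrow> real) \<Rightarrow> real" where
  "gibbs_mean \<mu> x a = (\<Sum>i\<in>UNIV. gibbs \<mu> i x * a i)"

lemma partition_function_pos: "(\<Sum>j\<in>UNIV. exp (x $ j / \<mu>)) > 0" for x :: "real ^ 'd"
  by (rule sum_pos) auto

lemma gibbs_nonneg: "gibbs \<mu> i x \<ge> 0"
  unfolding gibbs_def by (intro divide_nonneg_nonneg sum_nonneg) auto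

lemma sum_gibbs: "(\<Sum>i\<in>UNIV. gibbs \<mu> i x) = 1"
  unfolding gibbs_def sum_divide_distrib[symmetric]
  using partition_function_pos[of x \<mu>] by simp

lemma gibbs_mean_const [simp]: "gibbs_mean \<mu> x (\<lambda>i. c) = c"
  unfolding gibbs_mean_def by (simp add: sum_distrib_right[symmetric] sum_gibbs)

lemma gibbs_mean_add: "gibbs_mean \<mu> x (\<lambda>i. a i + b i) = gibbs_mean \<mu> x a + gibbs_mean \<mu> x b"
  unfolding gibbs_mean_def by (simp add: distrib_left sum.distrib)

lemma gibbs_mean_diff: "gibbs_mean \<mu> x (\<lambda>i. a i - b i) = gibbs_mean \<mu> x a - gibbs_mean \<mu> x b"
  unfolding gibbs_mean_def by (simp add: right_diff_distrib sum_subtractf)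

lemma gibbs_mean_mult_left: "gibbs_mean \<mu> x (\<lambda>i. c * a i) = c * gibbs_mean \<mu> x a"
  unfolding gibbs_mean_def by (simp add: sum_distrib_left mult.left_commute)

lemma gibbs_mean_mono: "(\<And>i. a i \<le> b i) \<Longrightarrow> gibbs_mean \<mu> x a \<le> gibbs_mean \<mu> x b"
  unfolding gibbs_mean_def by (intro sum_mono mult_left_mono gibbs_nonneg)

section \<open>Derivatives of the Gibbs weights, of Gibbs means and of \<open>smax\<close>\<close>

lemma exp_nth_has_derivative:
  "((\<lambda>x :: real ^ 'd. exp (x $ i / \<mu>)) has_derivative (\<lambda>k. exp (x $ i / \<mu>) * (k $ i / \<mu>))) (at x)"
proof -
  have "((\<lambda>x :: real ^ 'd. x $ i / \<mu>) has_derivative (\<lambda>k. k $ i / \<mu>)) (at x)"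
    by (intro bounded_linear_imp_has_derivative
        bounded_linear_compose[OF bounded_linear_divide bounded_linear_vec_nth])
  from has_derivative_exp[OF this] show ?thesis by (simp add: mult.commute)
qed

lemma partition_function_has_derivative:
  "((\<lambda>x :: real ^ 'd. \<Sum>j\<in>UNIV. exp (x $ j / \<mu>)) has_derivative
      (\<lambda>k. \<Sum>j\<in>UNIV. exp (x $ j / \<mu>) * (k $ j / \<mu>))) (at x)"
  by (intro has_derivative_sum exp_nth_has_derivative)

text \<open>Quotient rule: dividing by the partition function turns its derivative back into a Gibbs
  mean, so the result is quadratic in the weights.\<close>

lemma gibbs_has_derivative:
  "(gibbs \<mu> i has_derivative
      (\<lambda>k. gibbs \<mu> i x * (k $ i - gibbs_mean \<mu> x (\<lambda>j. k $ j)) / \<mu>)) (at x)"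
proof -
  define S where "S = (\<Sum>j\<in>UNIV. exp (x $ j / \<mu>))"
  have S: "S > 0" unfolding S_def by (rule partition_function_pos)
  have mean: "gibbs_mean \<mu> x (\<lambda>j. k $ j) / \<mu> = (\<Sum>j\<in>UNIV. exp (x $ j / \<mu>) * (k $ j / \<mu>)) / S" for k
    by (simp add: gibbs_mean_def gibbs_def S_def sum_divide_distrib mult.commute)
  have "((\<lambda>x. exp (x $ i / \<mu>) / (\<Sum>j\<in>UNIV. exp (x $ j / \<mu>))) has_derivative
      (\<lambda>k. (exp (x $ i / \<mu>) * (k $ i / \<mu>) * S
        - exp (x $ i / \<mu>) * (\<Sum>j\<in>UNIV. exp (x $ j / \<mu>) * (k $ j / \<mu>))) / (S * S))) (at x)"
    using has_derivative_divide'[OF exp_nth_has_derivative partition_function_has_derivative,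
        of x \<mu> i \<mu>] S
    unfolding S_def by simp
  moreover have "(exp (x $ i / \<mu>) * (k $ i / \<mu>) * S
        - exp (x $ i / \<mu>) * (\<Sum>j\<in>UNIV. exp (x $ j / \<mu>) * (k $ j / \<mu>))) / (S * S)
      = gibbs \<mu> i x * (k $ i - gibbs_mean \<mu> x (\<lambda>j. k $ j)) / \<mu>" for k
  proof -
    have "gibbs \<mu> i x = exp (x $ i / \<mu>) / S" by (simp add: gibbs_def S_def)
    then have "gibbs \<mu> i x * (k $ i - gibbs_mean \<mu> x (\<lambda>j. k $ j)) / \<mu>
        = exp (x $ i / \<mu>) / S * (k $ i / \<mu> - gibbs_mean \<mu> x (\<lambda>j. k $ j) / \<mu>)"
      by (simp add: diff_divide_distrib[symmetric] mult.commute)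
    also have "\<dots> = (exp (x $ i / \<mu>) * (k $ i / \<mu>) * S
        - exp (x $ i / \<mu>) * (\<Sum>j\<in>UNIV. exp (x $ j / \<mu>) * (k $ j / \<mu>))) / (S * S)"
      unfolding mean using S by (simp add: diff_divide_distrib right_diff_distrib)
    finally show ?thesis by simp
  qed
  ultimately show ?thesis
    unfolding gibbs_def[abs_def] by simp
qed

text \<open>The derivative in direction \<open>k\<close> is the covariance of \<open>a\<close> and
  \<open>k\<close> under the Gibbs distribution, divided by \<mu>.\<close>

lemma gibbs_mean_has_derivative:
  "((\<lambda>x. gibbs_mean \<mu> x a) has_derivative
      (\<lambda>k. (gibbs_mean \<mu> x (\<lambda>i. a i * k $ i)
        - gibbs_mean \<mu> x a * gibbs_mean \<mu> x (\<lambda>i. k $ i)) / \<mu>)) (at x)"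
proof -
  have "((\<lambda>x. gibbs_mean \<mu> x a) has_derivative
      (\<lambda>k. \<Sum>i\<in>UNIV. gibbs \<mu> i x * (k $ i - gibbs_mean \<mu> x (\<lambda>j. k $ j)) / \<mu> * a i)) (at x)"
    unfolding gibbs_mean_def[of _ _ a]
    by (intro has_derivative_sum has_derivative_mult_left gibbs_has_derivative)
  moreover have "(\<Sum>i\<in>UNIV. gibbs \<mu> i x * (k $ i - m) / \<mu> * a i)
      = (gibbs_mean \<mu> x (\<lambda>i. a i * k $ i) - gibbs_mean \<mu> x a * m) / \<mu>" for k m
    unfolding gibbs_mean_def sum_distrib_right sum_subtractf[symmetric] sum_divide_distrib
    by (intro sum.cong) (simp_all add: algebra_simps)
  ultimately show ?thesis by simp
qed

lemma smax_has_derivative: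
  assumes "\<mu> > 0"
  shows "(smax \<mu> has_derivative (\<lambda>k. gibbs_mean \<mu> x (\<lambda>i. k $ i))) (at x)"
proof -
  define S where "S = (\<Sum>j\<in>UNIV. exp (x $ j / \<mu>))"
  have S: "S > 0" unfolding S_def by (rule partition_function_pos)
  have "((\<lambda>x. \<mu> * ln (\<Sum>j\<in>UNIV. exp (x $ j / \<mu>))) has_derivative
      (\<lambda>k. \<mu> * ((\<Sum>j\<in>UNIV. exp (x $ j / \<mu>) * (k $ j / \<mu>)) * inverse S))) (at x)"
    using S unfolding S_def
    by (intro has_derivative_mult_right has_derivative_ln partition_function_has_derivative)
  moreover have "\<mu> * ((\<Sum>j\<in>UNIV. exp (x $ j / \<mu>) * (k $ j / \<mu>)) * inverse S)
      = gibbs_mean \<mu> x (\<lambda>i. k $ i)" for k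
    unfolding gibbs_mean_def gibbs_def S_def[symmetric] sum_distrib_left sum_distrib_right
    using assms S by (intro sum.cong) (simp_all add: field_simps)
  ultimately show ?thesis unfolding smax_def[abs_def] by simp
qed

section \<open>Polynomials in the Gibbs weights\<close>

text \<open>The coefficients lie in an arbitrary normed space, so a function and its derivative,
  valued in a space of bounded linear maps, can both be of this kind. This is what allows
  iteration.\<close>

inductive gibbs_poly :: "real \<Rightarrow> (real ^ 'd \<Rightarrow> 'b::real_normed_vector) \<Rightarrow> bool" for \<mu> where
  const: "gibbs_poly \<mu> (\<lambda>x. c)"
| add: "gibbs_poly \<mu> F \<Longrightarrow> gibbs_poly \<mu> G \<Longrightarrow> gibbs_poly \<mu> (\<lambda>x. F x + G x)"
| mult: "gibbs_poly \<mu> F \<Longrightarrow> gibbs_poly \<mu> (\<lambda>x. gibbs \<mu> i x *\<^sub>R F x)"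

lemma gibbs_poly_sum:
  "finite A \<Longrightarrow> (\<And>i. i \<in> A \<Longrightarrow> gibbs_poly \<mu> (F i)) \<Longrightarrow> gibbs_poly \<mu> (\<lambda>x. \<Sum>i\<in>A. F i x)"
  by (induction A rule: finite_induct) (auto intro: gibbs_poly.intros)

text \<open>A linear map passes through sums and scalar weights and acts on the coefficients
  alone.\<close>

lemma gibbs_poly_bounded_linear:
  assumes "gibbs_poly \<mu> F" and "bounded_linear T"
  shows "gibbs_poly \<mu> (\<lambda>x. T (F x))"
  using assms(1)
proof induction
  case (add F G)
  then show ?case
    by (simp add: linear_add[OF bounded_linear.linear[OF assms(2)]] gibbs_poly.add)
next
  case (mult F i)
  then show ?case
    by (simp add: linear_cmul[OF bounded_linear.linear[OF assms(2)]] gibbs_poly.mult)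
qed (rule gibbs_poly.const)

definition coord_blinfun :: "'d::finite \<Rightarrow> (real ^ 'd) \<Rightarrow>\<^sub>L real" where
  "coord_blinfun i = Blinfun (\<lambda>x. x $ i)"

lemma coord_blinfun_apply [simp]: "blinfun_apply (coord_blinfun i) x = x $ i"
  by (simp add: coord_blinfun_def bounded_linear_Blinfun_apply bounded_linear_vec_nth)

text \<open>Induction on the construction of \<open>F\<close>. The essential case is the product
  rule, where the derivative of a weight is itself a polynomial in the weights.\<close>

lemma gibbs_poly_has_derivative:
  fixes F :: "real ^ 'd \<Rightarrow> 'b::real_normed_vector"
  assumes "gibbs_poly \<mu> F"
  obtains D where "gibbs_poly \<mu> D" "\<And>x. (F has_derivative blinfun_apply (D x)) (at x)"
proof -
  from assms have "\<exists>D. gibbs_poly \<mu> D \<and> (\<forall>x. (F has_derivative blinfun_apply (D x)) (at x))"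
  proof induction
    case (const c)
    show ?case
      by (rule exI[of _ "\<lambda>x. 0"]) (simp add: gibbs_poly.const zero_blinfun.rep_eq)
  next
    case (add F G)
    then obtain D E where "gibbs_poly \<mu> D" "\<And>x. (F has_derivative blinfun_apply (D x)) (at x)"
      "gibbs_poly \<mu> E" "\<And>x. (G has_derivative blinfun_apply (E x)) (at x)" by blast
    then show ?case
      by (intro exI[of _ "\<lambda>x. D x + E x"])
        (auto simp: plus_blinfun.rep_eq intro!: gibbs_poly.add has_derivative_add)
  next
    case (mult F i)
    then obtain D where D: "gibbs_poly \<mu> D" "\<And>x. (F has_derivative blinfun_apply (D x)) (at x)"
      by blast
    \<comment> \<open>\<open>L j v\<close> is the map \<open>k\<close> to
      \<open>(k $ j / \<mu>) *\<^sub>R v\<close>. Written as a composition, it is visibly bounded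
      linear in \<open>v\<close> as well.\<close>
    define L where "L = (\<lambda>j (v :: 'b). blinfun_scaleR_left ((1 / \<mu>) *\<^sub>R v) o\<^sub>L coord_blinfun (j :: 'd))"
    have L_apply: "blinfun_apply (L j v) k = (k $ j / \<mu>) *\<^sub>R v" for j v k
      by (simp add: L_def)
    have lin: "bounded_linear (L j)" for j
      unfolding L_def
      by (intro bounded_linear_compose[OF bounded_bilinear.bounded_linear_left
            [OF bounded_bilinear_blinfun_compose]]
          bounded_linear_compose[OF bounded_linear_blinfun_scaleR_left] bounded_linear_scaleR_right)
    have lin': "bounded_linear (\<lambda>v. - L j v)" for j
      by (intro bounded_linear_minus lin)
    \<comment> \<open>This is the product rule with the Gibbs mean expanded into its sum over
      \<open>j\<close>, so that each term is a polynomial in the weights. The minus sign is absorbed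
      into the linear map, since \<open>gibbs_poly\<close> has no rule for negation.\<close>
    define E where "E = (\<lambda>x. (gibbs \<mu> i x *\<^sub>R L i (F x)
      + (\<Sum>j\<in>UNIV. gibbs \<mu> i x *\<^sub>R gibbs \<mu> j x *\<^sub>R (- L j (F x)))) + gibbs \<mu> i x *\<^sub>R D x)"
    have "gibbs_poly \<mu> E"
      unfolding E_def
      by (intro gibbs_poly.add gibbs_poly.mult gibbs_poly_sum D finite
          gibbs_poly_bounded_linear[OF mult.hyps lin] gibbs_poly_bounded_linear[OF mult.hyps lin'])
    moreover have "((\<lambda>x. gibbs \<mu> i x *\<^sub>R F x) has_derivative blinfun_apply (E x)) (at x)" for x
    proof -
      have "blinfun_apply (E x) k = gibbs \<mu> i x *\<^sub>R D x k
          + (gibbs \<mu> i x * (k $ i - gibbs_mean \<mu> x (\<lambda>j. k $ j)) / \<mu>) *\<^sub>R F x" for k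
      proof -
        have "(\<Sum>j\<in>UNIV. gibbs \<mu> i x *\<^sub>R gibbs \<mu> j x *\<^sub>R (- ((k $ j / \<mu>) *\<^sub>R F x)))
            = - (gibbs \<mu> i x * gibbs_mean \<mu> x (\<lambda>j. k $ j) / \<mu>) *\<^sub>R F x"
          unfolding gibbs_mean_def sum_distrib_left sum_divide_distrib sum_negf[symmetric] scaleR_sum_left
          by (intro sum.cong) simp_all
        then show ?thesis
          by (simp add: E_def L_apply blinfun.add_left blinfun.scaleR_left blinfun.minus_left
              blinfun.sum_left right_diff_distrib diff_divide_distrib scaleR_left_diff_distrib mult.assoc)
      qed
      then show ?thesis
        by (intro has_derivative_eq_rhs[OF has_derivative_scaleR[OF gibbs_has_derivative D(2)]]) auto
    qed
    ultimately show ?case by blast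
  qed
  then show ?thesis using that by blast
qed

lemma gibbs_poly_nabla: "gibbs_poly \<mu> F \<Longrightarrow> gibbs_poly \<mu> (nabla F)"
  by (metis gibbs_poly_has_derivative nabla_eqI ext)

lemma gibbs_poly_differentiable: "gibbs_poly \<mu> F \<Longrightarrow> F differentiable (at x)"
  by (metis gibbs_poly_has_derivative differentiableI)

text \<open>The iteration starts at the gradient: \<open>smax\<close> itself is unbounded, hence no
  polynomial in the weights.\<close>

lemma gibbs_poly_nabla_smax:
  assumes "\<mu> > 0"
  shows "gibbs_poly \<mu> (nabla (smax \<mu>) :: real ^ 'd \<Rightarrow> _)"
proof -
  have "nabla (smax \<mu>) x = (\<Sum>i\<in>UNIV. gibbs \<mu> i x *\<^sub>R coord_blinfun i)" for x :: "real ^ 'd"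
    by (rule nabla_eqI, rule has_derivative_eq_rhs[OF smax_has_derivative[OF assms]])
      (auto simp: gibbs_mean_def blinfun.bilinear_simps blinfun.sum_left)
  then have "nabla (smax \<mu>) = (\<lambda>x :: real ^ 'd. \<Sum>i\<in>UNIV. gibbs \<mu> i x *\<^sub>R coord_blinfun i)" by auto
  then show ?thesis
    by (auto intro!: gibbs_poly_sum gibbs_poly.mult gibbs_poly.const)
qed

section \<open>The fourth derivative as a cumulant\<close>

text \<open>Differentiation commutes with a bounded linear \<open>T\<close>. With \<open>T\<close>
  the evaluation at fixed vectors, the next derivative of a form is read off from a scalar function,
  without a formula for the form itself.\<close>

lemma bounded_linear_nabla_apply:
  assumes "F differentiable (at x)" "bounded_linear T"
    and "((\<lambda>y. T (F y)) has_derivative D) (at x)"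
  shows "T (blinfun_apply (nabla F x) k) = D k"
  using has_derivative_unique[OF assms(3)
      bounded_linear.has_derivative[OF assms(2) has_derivative_nabla[OF assms(1)]]]
  by (metis)

text \<open>The scalar obtained by evaluating each derivative at \<open>h\<close> is a polynomial in
  the raw moments \<open>M y n\<close>; differentiating it along \<open>h\<close> gives the next
  one.\<close>

lemma nabla4_form_smax:
  fixes x h :: "real ^ 'd"
  assumes "\<mu> > 0"
  defines "M \<equiv> \<lambda>x n. gibbs_mean \<mu> x (\<lambda>i. h $ i ^ n)"
  shows "nabla4_form (smax \<mu>) x h h h h =
    (M x 4 - 4 * M x 1 * M x 3 - 3 * (M x 2)\<^sup>2 + 12 * (M x 1)\<^sup>2 * M x 2 - 6 * M x 1 ^ 4) / \<mu> ^ 3"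
proof -
  let ?f1 = "nabla (smax \<mu>) :: real ^ 'd \<Rightarrow> _"
  let ?f2 = "nabla ?f1"
  let ?f3 = "nabla ?f2"
  note poly = gibbs_poly_nabla_smax[OF assms(1)]
  have diff: "?f1 differentiable (at y)" "?f2 differentiable (at y)" "?f3 differentiable (at y)" for y
    by (intro gibbs_poly_differentiable[of \<mu>] gibbs_poly_nabla poly)+
  define M' where "M' = (\<lambda>y n k. (gibbs_mean \<mu> y (\<lambda>i. h $ i ^ n * k $ i)
      - M y n * gibbs_mean \<mu> y (\<lambda>i. k $ i)) / \<mu>)"
  have M': "((\<lambda>y. M y n) has_derivative M' y n) (at y)" for y n
    unfolding M_def M'_def by (rule gibbs_mean_has_derivative)
  \<comment> \<open>Along \<open>h\<close> itself the covariance of \<open>h $ i ^ n\<close> and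
    \<open>h $ i\<close> involves only moments, so the moments are closed under
    differentiation.\<close>
  have M'_h: "M' y n h = (M y (Suc n) - M y n * M y 1) / \<mu>" for y n
    unfolding M_def M'_def by (simp add: mult.commute)
  have smax_diff: "smax \<mu> differentiable (at y)" for y :: "real ^ 'd"
    using smax_has_derivative[OF assms(1)] by (rule differentiableI)
  \<comment> \<open>The next three values are the mean, the variance and the third cumulant of
    \<open>h\<close>, scaled by 1, \<open>1 / \<mu>\<close> and \<open>1 / \<mu>\<^sup>2\<close>.
    They are stated for every \<open>y\<close> because each is differentiated in turn.\<close>
  have 1: "blinfun_apply (?f1 y) h = M y 1" for y
    unfolding M_def
    using bounded_linear_nabla_apply[OF smax_diff bounded_linear_ident smax_has_derivative[OF assms(1)]]
    by simp
  have 2: "blinfun_apply (blinfun_apply (?f2 y) h) h = (M y 2 - (M y 1)\<^sup>2) / \<mu>" for y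
  proof -
    have "((\<lambda>y. blinfun_apply (?f1 y) h) has_derivative M' y 1) (at y)"
      unfolding 1 by (rule M')
    from bounded_linear_nabla_apply[OF diff(1) blinfun.bounded_linear_left this]
    have "blinfun_apply (blinfun_apply (?f2 y) h) h = M' y 1 h" .
    then show ?thesis by (simp add: M'_h numeral_eq_Suc)
  qed
  have 3: "blinfun_apply (blinfun_apply (blinfun_apply (?f3 y) h) h) h
      = (M y 3 - 3 * M y 1 * M y 2 + 2 * M y 1 ^ 3) / \<mu>\<^sup>2" for y
  proof -
    have "((\<lambda>y. blinfun_apply (blinfun_apply (?f2 y) h) h) has_derivative
        (\<lambda>k. (M' y 2 k - 2 * M y 1 * M' y 1 k) / \<mu>)) (at y)"
      unfolding 2 divide_inverse
      by (auto intro!: derivative_eq_intros M' simp: algebra_simps simp del: One_nat_def)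
    from bounded_linear_nabla_apply[OF diff(2) bounded_linear_compose
        [OF blinfun.bounded_linear_left blinfun.bounded_linear_left] this]
    have eq: "blinfun_apply (blinfun_apply (blinfun_apply (?f3 y) h) h) h
        = (M' y 2 h - 2 * M y 1 * M' y 1 h) / \<mu>" .
    show ?thesis
      unfolding eq M'_h using assms(1) by (simp add: numeral_eq_Suc field_simps)
  qed
  have "((\<lambda>y. blinfun_apply (blinfun_apply (blinfun_apply (?f3 y) h) h) h) has_derivative
      (\<lambda>k. (M' x 3 k - 3 * (M' x 1 k * M x 2 + M x 1 * M' x 2 k) + 6 * (M x 1)\<^sup>2 * M' x 1 k) / \<mu>\<^sup>2)) (at x)"
    unfolding 3 divide_inverse
    by (auto intro!: derivative_eq_intros M' simp: algebra_simps simp del: One_nat_def)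
  from bounded_linear_nabla_apply[OF diff(3) bounded_linear_compose
      [OF blinfun.bounded_linear_left bounded_linear_compose
        [OF blinfun.bounded_linear_left blinfun.bounded_linear_left]] this]
  have eq: "nabla4_form (smax \<mu>) x h h h h
      = (M' x 3 h - 3 * (M' x 1 h * M x 2 + M x 1 * M' x 2 h) + 6 * (M x 1)\<^sup>2 * M' x 1 h) / \<mu>\<^sup>2"
    unfolding nabla4_form_def nabla4_def .
  show ?thesis
    unfolding eq M'_h using assms(1) by (simp add: numeral_eq_Suc field_simps)
qed

section \<open>Central moments and the bound\<close>

lemma fourth_cumulant:
  fixes \<mu> :: real and x h :: "real ^ 'd"
  defines "M \<equiv> \<lambda>n. gibbs_mean \<mu> x (\<lambda>i. h $ i ^ n)"
  shows "M 4 - 4 * M 1 * M 3 - 3 * (M 2)\<^sup>2 + 12 * (M 1)\<^sup>2 * M 2 - 6 * M 1 ^ 4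
    = gibbs_mean \<mu> x (\<lambda>i. (h $ i - M 1) ^ 4) - 3 * (gibbs_mean \<mu> x (\<lambda>i. (h $ i - M 1)\<^sup>2))\<^sup>2"
proof -
  define m where "m = M 1"
  \<comment> \<open>The binomial expansion keeps the exponent 1 and the grouped coefficients, so
    that linearity of the mean yields exactly the terms \<open>M n\<close>.\<close>
  have "(\<lambda>i. (h $ i - m) ^ 4)
      = (\<lambda>i. h $ i ^ 4 - (4 * m) * h $ i ^ 3 + (6 * m\<^sup>2) * h $ i ^ 2 - (4 * m ^ 3) * h $ i ^ 1 + m ^ 4)"
    by (rule ext) algebra
  then have 4: "gibbs_mean \<mu> x (\<lambda>i. (h $ i - m) ^ 4)
      = M 4 - 4 * m * M 3 + 6 * m\<^sup>2 * M 2 - 4 * m ^ 3 * M 1 + m ^ 4"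
    unfolding M_def by (simp only: gibbs_mean_add gibbs_mean_diff gibbs_mean_mult_left gibbs_mean_const)
  have "(\<lambda>i. (h $ i - m)\<^sup>2) = (\<lambda>i. h $ i ^ 2 - (2 * m) * h $ i ^ 1 + m\<^sup>2)"
    by (rule ext) algebra
  then have 2: "gibbs_mean \<mu> x (\<lambda>i. (h $ i - m)\<^sup>2) = M 2 - 2 * m * M 1 + m\<^sup>2"
    unfolding M_def by (simp only: gibbs_mean_add gibbs_mean_diff gibbs_mean_mult_left gibbs_mean_const)
  show ?thesis
    unfolding m_def[symmetric] 4 2 by (simp add: m_def[symmetric]) algebra
qed

text \<open>Both terms of the difference are nonnegative, so its absolute value is at most the
  larger of their bounds, \<open>4 * norm h ^ 4\<close> and \<open>3 * norm h ^ 4\<close>.\<close>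

lemma fourth_cumulant_bound:
  fixes \<mu> :: real and x h :: "real ^ 'd"
  defines "m \<equiv> gibbs_mean \<mu> x (\<lambda>i. h $ i)"
  shows "\<bar>gibbs_mean \<mu> x (\<lambda>i. (h $ i - m) ^ 4) - 3 * (gibbs_mean \<mu> x (\<lambda>i. (h $ i - m)\<^sup>2))\<^sup>2\<bar>
    \<le> 4 * norm h ^ 4"
proof -
  define N where "N = norm h"
  define V where "V = gibbs_mean \<mu> x (\<lambda>i. (h $ i - m)\<^sup>2)"
  have h: "\<bar>h $ i\<bar> \<le> N" for i
    unfolding N_def by (rule component_le_norm_cart)
  have "m \<le> N"
    using gibbs_mean_mono[of "\<lambda>i. h $ i" "\<lambda>i. N" \<mu> x] h unfolding m_def by (auto simp: abs_le_iff)
  moreover have "- N \<le> m"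
    using gibbs_mean_mono[of "\<lambda>i. - N" "\<lambda>i. h $ i" \<mu> x] h unfolding m_def
    by (auto simp: abs_le_iff minus_le_iff)
  ultimately have hm: "\<bar>h $ i - m\<bar> \<le> 2 * N" for i
    using h[of i] by linarith
  have V0: "V \<ge> 0"
    using gibbs_mean_mono[of "\<lambda>i. 0" "\<lambda>i. (h $ i - m)\<^sup>2" \<mu> x] by (simp add: V_def)
  \<comment> \<open>Writing the variance as second moment minus \<open>m\<^sup>2\<close> gives the
    bound \<open>N\<^sup>2\<close>; the pointwise estimate \<open>hm\<close> would only give
    \<open>4 * N\<^sup>2\<close>.\<close>
  have "(\<lambda>i. (h $ i - m)\<^sup>2) = (\<lambda>i. (h $ i)\<^sup>2 - (2 * m) * h $ i + m\<^sup>2)"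
    by (rule ext) algebra
  then have "V = gibbs_mean \<mu> x (\<lambda>i. (h $ i)\<^sup>2) - (2 * m) * m + m\<^sup>2"
    unfolding V_def by (simp only: gibbs_mean_add gibbs_mean_diff gibbs_mean_mult_left gibbs_mean_const m_def)
  also have "\<dots> \<le> gibbs_mean \<mu> x (\<lambda>i. (h $ i)\<^sup>2)"
    by (simp add: power2_eq_square)
  also have "\<dots> \<le> N\<^sup>2"
    using gibbs_mean_mono[of "\<lambda>i. (h $ i)\<^sup>2" "\<lambda>i. N\<^sup>2" \<mu> x] h
    by (simp add: power2_le_iff_abs_le N_def)
  finally have V1: "V \<le> N\<^sup>2" .
  \<comment> \<open>Only one of the two squares is bounded pointwise; the other averages to
    \<open>V\<close>. Bounding both pointwise would give the constant 16, which exceeds 15.\<close>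
  have "(h $ i - m) ^ 4 \<le> (2 * N)\<^sup>2 * (h $ i - m)\<^sup>2" for i
  proof -
    have "(h $ i - m)\<^sup>2 \<le> (2 * N)\<^sup>2"
      using power_mono[OF hm[of i], of 2] by simp
    then have "(h $ i - m)\<^sup>2 * (h $ i - m)\<^sup>2 \<le> (2 * N)\<^sup>2 * (h $ i - m)\<^sup>2"
      by (rule mult_right_mono) simp
    then show ?thesis by (simp add: power_add[symmetric])
  qed
  then have "gibbs_mean \<mu> x (\<lambda>i. (h $ i - m) ^ 4) \<le> (2 * N)\<^sup>2 * V"
    unfolding V_def gibbs_mean_mult_left[symmetric] by (rule gibbs_mean_mono)
  also have "\<dots> \<le> (2 * N)\<^sup>2 * N\<^sup>2"
    by (rule mult_left_mono[OF V1]) simp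
  also have "\<dots> = 4 * N ^ 4" by algebra
  finally have upper: "gibbs_mean \<mu> x (\<lambda>i. (h $ i - m) ^ 4) \<le> 4 * N ^ 4" .
  have lower: "gibbs_mean \<mu> x (\<lambda>i. (h $ i - m) ^ 4) \<ge> 0"
    using gibbs_mean_mono[of "\<lambda>i. 0" "\<lambda>i. (h $ i - m) ^ 4" \<mu> x] by simp
  have "V\<^sup>2 \<le> N ^ 4"
    using power_mono[OF V1 V0, of 2] by simp
  moreover have "V\<^sup>2 \<ge> 0" "N ^ 4 \<ge> 0" by simp_all
  ultimately show ?thesis
    using upper lower unfolding V_def[symmetric] N_def[symmetric] by linarith
qed

theorem lemma3p2:
  fixes \<mu> :: real and x h :: "real ^ 'd"
  assumes "\<mu> > 0"
  shows "\<bar>nabla4_form (smax \<mu>) x h h h h\<bar> \<le> 15 / \<mu> ^ 3 * norm h ^ 4"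
proof -
  define m where "m = gibbs_mean \<mu> x (\<lambda>i. h $ i)"
  have "nabla4_form (smax \<mu>) x h h h h
      = (gibbs_mean \<mu> x (\<lambda>i. (h $ i - m) ^ 4) - 3 * (gibbs_mean \<mu> x (\<lambda>i. (h $ i - m)\<^sup>2))\<^sup>2) / \<mu> ^ 3"
    unfolding nabla4_form_smax[OF assms] fourth_cumulant by (simp add: m_def)
  then have "\<bar>nabla4_form (smax \<mu>) x h h h h\<bar> \<le> 4 * norm h ^ 4 / \<mu> ^ 3"
    using fourth_cumulant_bound[of \<mu> x h] assms
    by (simp add: m_def divide_right_mono abs_divide)
  \<comment> \<open>Only 4 \<le> 15 is used here.\<close>
  also have "\<dots> \<le> 15 / \<mu> ^ 3 * norm h ^ 4"
    using assms by (simp add: divide_right_mono)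
  finally show ?thesis .
qed

end
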